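(* Assume $F_P\neq\emptyset$ and $F_D\neq\emptyset$. The following are equivalent: (i) $v_P=v_D$; (ii) there exists a solution $x=(x_1,\dots,x_{n^2})^T$ of $(PP_{opt})$ with $x_i\neq\infty$ for $i=1,\dots,n^2$; (iii) there exists a solution $\lambda$ of $(DP_{opt})$ with $A_{eq}A_{\pi_1}^T\lambda=2g-(n+1)\mathbf{1}_k$.
   Context: Let $n\ge 2$ be an integer and $s(m)=\sum_{i=1}^{m-1} i$. Define matrices $A(m)$ with $s(m)$ rows and $m$ columns recursively: $A(1)$ is the empty matrix, and for $m\ge 2$, $A(m)=\begin{pmatrix}\mathbf{1}_{m-1} & -U_{m-1}\\ \mathbf{0}_{s(m-1)} & A(m-1)\end{pmatrix}$, where $\mathbf{1}_{m-1}$ is the column vector of ones, $U_{m-1}$ is the identity matrix and $\mathbf{0}_{s(m-1)}$ the zero column of length $s(m-1)$. Let $A$ be the $n\,s(n)\times n^2$ block-diagonal matrix with $n$ copies of $A(n)$ on its diagonal. For a permutation $\pi$ of $\{1,\dots,n^2\}$ let $A_\pi=(a^{\pi^{-1}(1)},\dots,a^{\pi^{-1}(n^2)})$, $a^j$ the $j$-th column of $A$. Fix permutations $\pi_1,\pi_2,\pi_3$ of $\{1,\dots,n^2\}$, $0\le k\le n^2$, an index set $\{i_1,\dots,i_k\}\subset\{1,\dots,n^2\}$, integers $g_{i_l}\in[1,n]$, $g=(g_{i_1},\dots,g_{i_k})^T$, and $A_{eq}$ the $k\times n^2$ matrix with $[A_{eq}x]_l=x_{i_l}$. $\mathbf 1_k$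 is the vector of $k$ ones. Let $\mathbb{Z}_\infty=\mathbb{Z}\cup\{\infty\}$, where $\infty$ is a formal token with $\infty+x=x+\infty=\infty+\infty=\infty$ for $x\in\mathbb{Z}$, $0\cdot\infty=\infty\cdot 0=0$, $x\cdot\infty=\infty\cdot x=\infty$ for $x\in\mathbb Z\setminus\{0\}$, and $\infty\ne x$ for every $x\in\mathbb{Z}$ (in particular $\infty\neq0$); matrix–vector products are extended using these rules. For a vector $y$, $y<>\mathbf{0}$ means every component of $y$ is different from $0$. $F_P=\{x\in\mathbb{Z}_\infty^{n^2}\mid$ for each $i$, $1\le x_i\le n$ or $x_i=\infty$; $A_{\pi_r}x<>\mathbf{0}$ for $r=1,2,3$; $A_{eq}x=g\}$, $f_P(x)=\sharp\{i\mid x_i=\infty\}$; $(PP_{opt})$: minimize $f_P$ over $F_P$, with optimal value $v_P=\min\{f_P(x)\mid x\in F_P\}$; $x$ solves $(PP_{opt})$ if $x\in F_P$ and $f_P(x)=v_P$. $F_D=\{\lambda\in\{-1,+1\}^{n\cdot s(n)}\mid A_{\pi_r}A_{\pi_1}^T\lambda<>\mathbf{0}\text{ for }r=1,2,3\}$, $f_D(\lambda)=\sharp\{1\le l\le k\mid [A_{eq}A_{\pi_1}^T\lambda]_l=2g_{i_l}-(n+1)\}-k$; $(DP_{opt})$: maximize $f_D$ over $F_D$, with optimal value $v_D=\max\{f_D(\lambda)\mid \lambda\in F_D\}$; $\lambda$ solves $(DP_{opt})$ if $\lambda\in F_D$ and $f_D(\lambda)=v_D$. *)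

theory Defs
  imports "Jordan_Normal_Form.Matrix" "HOL-Combinatorics.Permutations"
begin

text \<open>
  All indices (rows, columns, positions of a vector) are 0-based, following the matrix library:
  the index range $1,\dots,n^2$ becomes \<open>{..<n^2}\<close>, and permutations act on \<open>{..<n^2}\<close>.
  The values of the variables still range over $1,\dots,n$.
\<close>

datatype zinf = Fin int | Infty

instantiation zinf :: "{comm_monoid_add, times}"
begin

definition zero_zinf :: zinf where
  "0 = Fin 0"

fun plus_zinf :: "zinf \<Rightarrow> zinf \<Rightarrow> zinf" where
  "Fin x + Fin y = Fin (x + y)"
| "Infty + y = Infty"
| "x + Infty = Infty"

fun times_zinf :: "zinf \<Rightarrow> zinf \<Rightarrow> zinf" where
  "Fin x * Fin y = Fin (x * y)"
| "Fin x * Infty = (if x = 0 then 0 else Infty)"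
| "Infty * Fin x = (if x = 0 then 0 else Infty)"
| "Infty * Infty = Infty"

instance
proof
  fix a b c :: zinf
  show "a + b + c = a + (b + c)"
    by (cases a; cases b; cases c) simp_all
  show "a + b = b + a"
    by (cases a; cases b) simp_all
  show "0 + a = a"
    by (cases a) (simp_all add: zero_zinf_def)
qed

end

text \<open>
  \<^typ>\<open>zinf\<close> is not distributive, since \<open>Infty * (Fin 1 + Fin (-1)) = 0\<close> but
  \<open>Infty * Fin 1 + Infty * Fin (-1) = Infty\<close>. It is therefore not a \<open>semiring_0\<close>, and
  the library's matrix-vector product does not apply to it.
\<close>

definition mult_mat_zvec :: "int mat \<Rightarrow> zinf vec \<Rightarrow> zinf vec" where
  "mult_mat_zvec B x = vec (dim_row B) (\<lambda>i. \<Sum>j<dim_vec x. Fin (B $$ (i, j)) * x $ j)"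

text \<open>The relation $y <> \mathbf{0}$: every component is different from zero.\<close>

definition all_nonzero :: "'a :: zero vec \<Rightarrow> bool" where
  "all_nonzero y \<longleftrightarrow> (\<forall>i<dim_vec y. y $ i \<noteq> 0)"

definition s_num :: "nat \<Rightarrow> nat" where
  "s_num m = (\<Sum>i\<in>{1..<m}. i)"

text \<open>The value at 0 is a dummy.\<close>

fun A_rec :: "nat \<Rightarrow> int mat" where
  "A_rec 0 = 0\<^sub>m 0 0"
| "A_rec (Suc 0) = 0\<^sub>m 0 1"
| "A_rec (Suc (Suc m)) =
    four_block_mat (mat (Suc m) 1 (\<lambda>_. 1)) (- 1\<^sub>m (Suc m))
                   (0\<^sub>m (s_num (Suc m)) 1)      (A_rec (Suc m))"

definition A_mat :: "nat \<Rightarrow> int mat" where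
  "A_mat n = diag_block_mat (replicate n (A_rec n))"

text \<open>\<open>inv_into UNIV \<pi>\<close> is the inverse permutation; the notation \<open>inv\<close> is taken by HOL-Algebra.\<close>

definition A_perm :: "nat \<Rightarrow> (nat \<Rightarrow> nat) \<Rightarrow> int mat" where
  "A_perm n \<pi> = mat (n * s_num n) (n\<^sup>2) (\<lambda>(i, j). A_mat n $$ (i, inv_into UNIV \<pi> j))"

text \<open>
  The index set $\{i_1,\dots,i_k\}$ is enumerated by \<open>idx\<close> on \<open>{..<k}\<close>; the given values
  \<open>g\<close> are indexed by positions, so that $g_{i_l}$ is \<open>g (idx l)\<close>.
\<close>

definition A_eq :: "nat \<Rightarrow> nat \<Rightarrow> (nat \<Rightarrow> nat) \<Rightarrow> int mat" where
  "A_eq n k idx = mat k (n\<^sup>2) (\<lambda>(l, j). if j = idx l then 1 else 0)"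

definition g_vec :: "nat \<Rightarrow> (nat \<Rightarrow> nat) \<Rightarrow> (nat \<Rightarrow> int) \<Rightarrow> int vec" where
  "g_vec k idx g = vec k (\<lambda>l. g (idx l))"

lemma A_rec_carrier: "m \<ge> 1 \<Longrightarrow> A_rec m \<in> carrier_mat (s_num m) m"
proof (induction m rule: A_rec.induct)
  case (3 m)
  then have "A_rec (Suc m) \<in> carrier_mat (s_num (Suc m)) (Suc m)"
    by simp
  then show ?case
    by (auto simp: s_num_def Let_def)
qed (auto simp: s_num_def)

lemma A_mat_carrier:
  assumes "n \<ge> 1"
  shows "A_mat n \<in> carrier_mat (n * s_num n) (n\<^sup>2)"
  using A_rec_carrier[OF assms]
  by (auto simp: A_mat_def dim_diag_block_mat sum_list_replicate power2_eq_square)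

lemma A_eq_mult_zvec:
  assumes "x \<in> carrier_vec (n\<^sup>2)" "l < k" "idx l < n\<^sup>2"
  shows "mult_mat_zvec (A_eq n k idx) x $ l = x $ idx l"
proof -
  have *: "Fin (if P then 1 else 0) * y = (if P then y else 0)" for P and y :: zinf
    by (cases y) (auto simp: zero_zinf_def)
  have "mult_mat_zvec (A_eq n k idx) x $ l = (\<Sum>j<n\<^sup>2. Fin (A_eq n k idx $$ (l, j)) * x $ j)"
    using assms by (simp add: mult_mat_zvec_def A_eq_def)
  also have "\<dots> = (\<Sum>j<n\<^sup>2. if j = idx l then x $ j else 0)"
    using assms by (intro sum.cong) (simp_all only: lessThan_iff A_eq_def index_mat prod.case *)
  finally have "mult_mat_zvec (A_eq n k idx) x $ l = (\<Sum>j<n\<^sup>2. if j = idx l then x $ j else 0)" .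
  then show ?thesis
    using assms by (simp add: sum.delta)
qed

definition F_P ::
  "nat \<Rightarrow> (nat \<Rightarrow> nat \<Rightarrow> nat) \<Rightarrow> nat \<Rightarrow> (nat \<Rightarrow> nat) \<Rightarrow> (nat \<Rightarrow> int) \<Rightarrow> zinf vec set" where
  "F_P n \<pi> k idx g =
    {x \<in> carrier_vec (n\<^sup>2).
       (\<forall>i<n\<^sup>2. x $ i \<in> Fin ` {1..int n} \<or> x $ i = Infty) \<and>
       (\<forall>r\<in>{1,2,3}. all_nonzero (mult_mat_zvec (A_perm n (\<pi> r)) x)) \<and>
       mult_mat_zvec (A_eq n k idx) x = map_vec Fin (g_vec k idx g)}"

definition f_P :: "zinf vec \<Rightarrow> int" where
  "f_P x = int (card {i. i < dim_vec x \<and> x $ i = Infty})"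

text \<open>The minimum and maximum below are attained whenever the feasible set is nonempty, since
  the objectives take only finitely many values.\<close>

definition v_P ::
  "nat \<Rightarrow> (nat \<Rightarrow> nat \<Rightarrow> nat) \<Rightarrow> nat \<Rightarrow> (nat \<Rightarrow> nat) \<Rightarrow> (nat \<Rightarrow> int) \<Rightarrow> int" where
  "v_P n \<pi> k idx g = Min (f_P ` F_P n \<pi> k idx g)"

definition solves_P ::
  "nat \<Rightarrow> (nat \<Rightarrow> nat \<Rightarrow> nat) \<Rightarrow> nat \<Rightarrow> (nat \<Rightarrow> nat) \<Rightarrow> (nat \<Rightarrow> int) \<Rightarrow> zinf vec \<Rightarrow> bool" where
  "solves_P n \<pi> k idx g x \<longleftrightarrow> x \<in> F_P n \<pi> k idx g \<and> f_P x = v_P n \<pi> k idx g"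

definition F_D :: "nat \<Rightarrow> (nat \<Rightarrow> nat \<Rightarrow> nat) \<Rightarrow> int vec set" where
  "F_D n \<pi> =
    {l \<in> carrier_vec (n * s_num n).
       (\<forall>i<n * s_num n. l $ i \<in> {-1, 1}) \<and>
       (\<forall>r\<in>{1,2,3}. all_nonzero (A_perm n (\<pi> r) *\<^sub>v ((A_perm n (\<pi> 1))\<^sup>T *\<^sub>v l)))}"

definition f_D ::
  "nat \<Rightarrow> (nat \<Rightarrow> nat \<Rightarrow> nat) \<Rightarrow> nat \<Rightarrow> (nat \<Rightarrow> nat) \<Rightarrow> (nat \<Rightarrow> int) \<Rightarrow> int vec \<Rightarrow> int" where
  "f_D n \<pi> k idx g l =
    int (card {j. j < k \<and>
      (A_eq n k idx *\<^sub>v ((A_perm n (\<pi> 1))\<^sup>T *\<^sub>v l)) $ j = 2 * g (idx j) - (int n + 1)}) - int k"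

definition v_D ::
  "nat \<Rightarrow> (nat \<Rightarrow> nat \<Rightarrow> nat) \<Rightarrow> nat \<Rightarrow> (nat \<Rightarrow> nat) \<Rightarrow> (nat \<Rightarrow> int) \<Rightarrow> int" where
  "v_D n \<pi> k idx g = Max (f_D n \<pi> k idx g ` F_D n \<pi>)"

definition solves_D ::
  "nat \<Rightarrow> (nat \<Rightarrow> nat \<Rightarrow> nat) \<Rightarrow> nat \<Rightarrow> (nat \<Rightarrow> nat) \<Rightarrow> (nat \<Rightarrow> int) \<Rightarrow> int vec \<Rightarrow> bool" where
  "solves_D n \<pi> k idx g l \<longleftrightarrow> l \<in> F_D n \<pi> \<and> f_D n \<pi> k idx g l = v_D n \<pi> k idx g"

end

theory Submission
  imports Defs
begin

text \<open>
  \<open>A\<close> is the oriented incidence matrix of the disjoint union of \<open>n\<close> complete graphs on \<open>n\<close>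
  vertices, so a sign vector \<open>\<lambda>\<close> is a tournament on each block and \<open>A\<^sup>T \<lambda>\<close> is its vector of
  wins minus losses. These differences have the form \<open>2 w - (n - 1)\<close> with \<open>0 \<le> w \<le> n - 1\<close>, hence
  \<open>A\<^sub>\<pi>\<^sup>T \<lambda> = 2 x - (n + 1) \<one>\<close> for some \<open>x\<close> with entries in \<open>{1..n}\<close>. Conversely, an \<open>x\<close> that is
  injective on the blocks arises from the tournament \<open>\<lambda> = sgn (A\<^sub>\<pi> x)\<close>. As \<open>A\<^sub>\<pi> \<one> = 0\<close>, the
  inequations carry over, and finite points of the primal correspond to dual points satisfying
  all equations. Everything else follows from \<open>v\<^sub>D \<le> 0 \<le> v\<^sub>P\<close>.
\<close>

section \<open>The matrices as oriented incidence matrices\<close>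

text \<open>The bijection \<open>p\<close> names the edge belonging to each row: 1 at its first end,
  -1 at its second. Keeping \<open>p\<close> existential later avoids any commitment to the row
  order that the recursion produces.\<close>

definition oriented_incidence ::
  "int mat \<Rightarrow> (nat \<Rightarrow> nat \<times> nat) \<Rightarrow> (nat \<times> nat) set \<Rightarrow> bool" where
  "oriented_incidence M p E \<longleftrightarrow> bij_betw p {..<dim_row M} E \<and>
    (\<forall>i<dim_row M. \<forall>j<dim_col M.
       M $$ (i, j) = of_bool (j = fst (p i)) - of_bool (j = snd (p i)))"

lemma bij_betw_append:
  fixes r s :: nat
  assumes "bij_betw p {..<r} D" "bij_betw q {..<s} E" "D \<inter> E = {}"
  shows "bij_betw (\<lambda>i. if i < r then p i else q (i - r)) {..<r + s} (D \<union> E)"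
proof -
  let ?h = "\<lambda>i. if i < r then p i else q (i - r)"
  have 1: "bij_betw ?h {..<r} D"
    using assms(1) by (subst bij_betw_cong[where g = p]) auto
  have "bij_betw (\<lambda>i. i - r) {r..<r + s} {..<s}"
    by (rule bij_betwI[where g = "\<lambda>i. i + r"]) auto
  then have "bij_betw (q \<circ> (\<lambda>i. i - r)) {r..<r + s} E"
    using assms(2) by (rule bij_betw_trans)
  then have 2: "bij_betw ?h {r..<r + s} E"
    by (subst bij_betw_cong[where g = "q \<circ> (\<lambda>i. i - r)"]) auto
  have "{..<r + s} = {..<r} \<union> {r..<r + s}"
    by auto
  then show ?thesis
    using bij_betw_combine[OF 1 2 assms(3)] by simp
qed

lemma mem_shift_image_iff:
  fixes a b c :: nat
  shows "(a, b) \<in> map_prod ((+) c) ((+) c) ` E \<longleftrightarrow> c \<le> a \<and> c \<le> b \<and> (a - c, b - c) \<in> E"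
proof
  assume R: "c \<le> a \<and> c \<le> b \<and> (a - c, b - c) \<in> E"
  then have "map_prod ((+) c) ((+) c) (a - c, b - c) \<in> map_prod ((+) c) ((+) c) ` E"
    by blast
  then show "(a, b) \<in> map_prod ((+) c) ((+) c) ` E"
    using R by simp
qed auto

text \<open>Serves both the recursion of \<open>A_rec\<close> and the block diagonal. The top rows
  carry the edges \<open>D\<close>; the lower rows carry the edges of \<open>M\<close> with all
  vertices moved past the first \<open>c\<close> columns. Edges in \<open>D\<close> start below
  \<open>c\<close> and shifted edges do not, so the two sets are disjoint. The second end of an edge
  in \<open>D\<close> may lie in either column group.\<close>

lemma oriented_incidence_four_block:
  assumes M: "oriented_incidence M p E" "M \<in> carrier_mat r' c'"
    and T: "T1 \<in> carrier_mat r c" "T2 \<in> carrier_mat r c'"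
    and q: "bij_betw q {..<r} D" "\<And>a b. (a, b) \<in> D \<Longrightarrow> a < c"
    and T1: "\<And>i j. i < r \<Longrightarrow> j < c \<Longrightarrow>
      T1 $$ (i, j) = of_bool (j = fst (q i)) - of_bool (j = snd (q i))"
    and T2: "\<And>i j. i < r \<Longrightarrow> j < c' \<Longrightarrow>
      T2 $$ (i, j) = of_bool (c + j = fst (q i)) - of_bool (c + j = snd (q i))"
  shows "\<exists>p'. oriented_incidence (four_block_mat T1 T2 (0\<^sub>m r' c) M) p'
           (D \<union> map_prod ((+) c) ((+) c) ` E)"
proof -
  let ?s = "map_prod ((+) c) ((+) c)"
  let ?h = "\<lambda>i. if i < r then q i else (?s \<circ> p) (i - r)"
  have inj: "inj_on ?s E"
    by (auto simp: inj_on_def)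
  have p: "bij_betw p {..<r'} E"
    and Mp: "\<And>i j. i < r' \<Longrightarrow> j < c' \<Longrightarrow>
      M $$ (i, j) = of_bool (j = fst (p i)) - of_bool (j = snd (p i))"
    using M by (auto simp: oriented_incidence_def)
  have "bij_betw (?s \<circ> p) {..<r'} (?s ` E)"
    using p inj by (intro bij_betw_trans[OF p] bij_betw_imageI) auto
  moreover have "D \<inter> ?s ` E = {}"
    using q(2) by force
  ultimately have "bij_betw ?h {..<r + r'} (D \<union> ?s ` E)"
    using q(1) by (intro bij_betw_append)
  moreover have "dim_row (four_block_mat T1 T2 (0\<^sub>m r' c) M) = r + r'"
    "dim_col (four_block_mat T1 T2 (0\<^sub>m r' c) M) = c + c'"
    using M T by auto
  moreover have "four_block_mat T1 T2 (0\<^sub>m r' c) M $$ (i, j) =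
      of_bool (j = fst (?h i)) - of_bool (j = snd (?h i))" if "i < r + r'" "j < c + c'" for i j
  proof -
    have [simp]: "dim_row T1 = r" "dim_col T1 = c" "dim_row M = r'" "dim_col M = c'"
      using M T by auto
    show ?thesis
    proof (cases "i < r")
      case True
      then show ?thesis
        using that T1[of i j] T2[of i "j - c"] by (cases "j < c") auto
    next
      case False
      then have "i - r < r'"
        using that by auto
      then show ?thesis
        using that False Mp[of "i - r" "j - c"] by (cases "j < c") auto
    qed
  qed
  ultimately show ?thesis
    unfolding oriented_incidence_def by (intro exI[of _ ?h]) presburger
qed

text \<open>The top rows of the recursion are the edges from vertex 0 to every other vertex; the
  lower block is the complete graph on the remaining vertices, shifted by 1.\<close>

lemma oriented_incidence_A_rec:
  "\<exists>p. oriented_incidence (A_rec (Suc m)) p {(a, b). a < b \<and> b < Suc m}"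
proof (induction m)
  case 0
  have "{(a, b). a < b \<and> b < Suc 0} = {}"
    by auto
  then show ?case
    by (simp only: oriented_incidence_def A_rec.simps) (simp add: bij_betw_def)
next
  case (Suc m)
  then obtain p where p: "oriented_incidence (A_rec (Suc m)) p {(a, b). a < b \<and> b < Suc m}"
    by blast
  let ?D = "(\<lambda>i. (0::nat, Suc i)) ` {..<Suc m}"
  have D: "bij_betw (\<lambda>i. (0::nat, Suc i)) {..<Suc m} ?D"
    by (rule inj_on_imp_bij_betw) (auto simp: inj_on_def)
  have E: "{(a, b). a < b \<and> b < Suc (Suc m)} =
      ?D \<union> map_prod ((+) 1) ((+) 1) ` {(a, b). a < b \<and> b < Suc m}" (is "?L = ?R")
  proof -
    have "(a, b) \<in> ?L \<longleftrightarrow> (a, b) \<in> ?R" for a b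
      unfolding Un_iff mem_shift_image_iff by (cases a; cases b) auto
    then show ?thesis
      by (intro equalityI subrelI) blast+
  qed
  show ?case
    unfolding A_rec.simps E
    by (rule oriented_incidence_four_block[OF p A_rec_carrier _ _ D]) auto
qed

text \<open>Induction on the number of copies: the first copy occupies block 0, and shifting by
  \<open>m\<close> raises both quotients by one, so pairs within a block stay within a
  block.\<close>

lemma oriented_incidence_diag_block_mat:
  assumes B: "B \<in> carrier_mat r m" "oriented_incidence B p {(a, b). a < b \<and> b < m}" and "m > 0"
  shows "\<exists>q. oriented_incidence (diag_block_mat (replicate c B)) q
           {(a, b). a < b \<and> b < c * m \<and> a div m = b div m}"
proof (induction c)
  case 0
  show ?case
    by (auto simp: oriented_incidence_def bij_betw_def)
next
  case (Suc c)
  let ?C = "diag_block_mat (replicate c B)"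
  let ?D = "{(a, b). a < b \<and> b < m}"
  let ?E = "{(a, b). a < b \<and> b < c * m \<and> a div m = b div m}"
  from Suc obtain q where q: "oriented_incidence ?C q ?E"
    by blast
  have C: "?C \<in> carrier_mat (c * r) (c * m)"
    using B by (auto simp: dim_diag_block_mat sum_list_replicate)
  have bij: "bij_betw p {..<r} ?D" and Bp: "\<And>i j. i < r \<Longrightarrow> j < m \<Longrightarrow>
      B $$ (i, j) = of_bool (j = fst (p i)) - of_bool (j = snd (p i))"
    using B by (auto simp: oriented_incidence_def)
  have less: "fst (p i) < m \<and> snd (p i) < m" if "i < r" for i
    using bspec[OF bij_betwE[OF bij], of i] that by (simp add: split_beta)
  have E: "{(a, b). a < b \<and> b < Suc c * m \<and> a div m = b div m} =
      ?D \<union> map_prod ((+) m) ((+) m) ` ?E" (is "?L = ?R")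
  proof -
    have "(a, b) \<in> ?L \<longleftrightarrow> (a, b) \<in> ?R" for a b
    proof (cases "m \<le> a")
      case True
      then show ?thesis
        unfolding Un_iff mem_shift_image_iff using \<open>m > 0\<close>
        by (cases "m \<le> b") (auto simp: le_div_geq)
    next
      \<comment> \<open>Here \<open>a\<close> lies in block 0, so the pair cannot be a shifted one,
        and equal quotients mean exactly that \<open>b\<close> is also below
        \<open>m\<close>.\<close>
      case False
      then have "a div m = 0"
        by simp
      then show ?thesis
        unfolding Un_iff mem_shift_image_iff using False \<open>m > 0\<close> by (auto simp: div_eq_0_iff)
    qed
    then show ?thesis
      by (intro equalityI subrelI) blast+
  qed
  have "diag_block_mat (replicate (Suc c) B) =
      four_block_mat B (0\<^sub>m r (c * m)) (0\<^sub>m (c * r) m) ?C"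
    using B C by (auto simp: Let_def)
  moreover have "\<exists>q. oriented_incidence
      (four_block_mat B (0\<^sub>m r (c * m)) (0\<^sub>m (c * r) m) ?C) q (?D \<union> map_prod ((+) m) ((+) m) ` ?E)"
    by (rule oriented_incidence_four_block[OF q C B(1) _ bij])
      (use Bp less in \<open>fastforce+\<close>)
  ultimately show ?case
    unfolding E by simp
qed

text \<open>The quotient by \<open>n\<close> is the number of the diagonal block, so this is the
  edge set of \<open>n\<close> disjoint complete graphs on \<open>n\<close> vertices, each edge
  directed towards the larger index.\<close>

definition block_pairs :: "nat \<Rightarrow> (nat \<times> nat) set" where
  "block_pairs n = {(a, b). a < b \<and> b < n\<^sup>2 \<and> a div n = b div n}"

lemma oriented_incidence_A_mat:
  assumes "n \<ge> 1"
  shows "\<exists>p. oriented_incidence (A_mat n) p (block_pairs n)"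
proof -
  obtain p where "oriented_incidence (A_rec n) p {(a, b). a < b \<and> b < n}"
    using oriented_incidence_A_rec[of "n - 1"] assms by auto
  from oriented_incidence_diag_block_mat[OF A_rec_carrier[OF assms] this, of n] show ?thesis
    using assms by (simp add: A_mat_def block_pairs_def power2_eq_square)
qed

section \<open>Products with the permuted matrix and its transpose\<close>

text \<open>Column \<open>\<pi> j\<close> of \<open>A_perm n \<pi>\<close> is column
  \<open>j\<close> of \<open>A_mat n\<close>, so the product reads \<open>z\<close> along
  \<open>\<pi>\<close>, and a row takes the difference across its edge. Nonvanishing of all rows
  thus says that \<open>z\<close> along \<open>\<pi>\<close> is injective on every block.\<close>

lemma A_mult_vec:
  assumes "n \<ge> 1" and inc: "oriented_incidence (A_mat n) p (block_pairs n)"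
    and \<pi>: "\<pi> permutes {..<n\<^sup>2}" and z: "z \<in> carrier_vec (n\<^sup>2)" and i: "i < n * s_num n"
  shows "(A_perm n \<pi> *\<^sub>v z) $ i = z $ \<pi> (fst (p i)) - z $ \<pi> (snd (p i))"
proof -
  have "p i \<in> block_pairs n"
    using inc i A_mat_carrier[OF assms(1)] by (auto simp: oriented_incidence_def dest: bij_betwE)
  then have less: "fst (p i) < n\<^sup>2" "snd (p i) < n\<^sup>2"
    by (auto simp: block_pairs_def)
  have "(A_perm n \<pi> *\<^sub>v z) $ i = (\<Sum>j<n\<^sup>2. A_mat n $$ (i, inv_into UNIV \<pi> j) * z $ j)"
    using i z by (simp add: A_perm_def scalar_prod_def atLeast0LessThan)
  also have "\<dots> = (\<Sum>j<n\<^sup>2. A_mat n $$ (i, j) * z $ \<pi> j)"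
    using \<pi> by (intro sum.reindex_bij_witness[where i = \<pi> and j = "inv_into UNIV \<pi>"])
      (auto simp: permutes_inverses permutes_in_image[OF \<pi>]
        permutes_in_image[OF permutes_inv[OF \<pi>], unfolded lessThan_iff]
        permutes_in_image[OF \<pi>, unfolded lessThan_iff])
  also have "\<dots> = (\<Sum>j<n\<^sup>2. of_bool (j = fst (p i)) * z $ \<pi> j - of_bool (j = snd (p i)) * z $ \<pi> j)"
    using inc i A_mat_carrier[OF assms(1)]
    by (intro sum.cong) (auto simp: oriented_incidence_def left_diff_distrib)
  also have "\<dots> = z $ \<pi> (fst (p i)) - z $ \<pi> (snd (p i))"
    using less by (simp add: sum_subtractf of_bool_def if_distrib[where f = "\<lambda>x. x * _"] cong: if_cong)
  finally show ?thesis .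
qed

text \<open>The row weights \<open>l\<close> are extended to an antisymmetric \<open>f\<close> on
  pairs of vertices. An edge at \<open>v\<close> then contributes \<open>f v w\<close> whichever of
  its ends \<open>v\<close> is, since antisymmetry absorbs the incidence sign.\<close>

lemma A_transpose_mult_vec:
  assumes "n \<ge> 1" and inc: "oriented_incidence (A_mat n) p (block_pairs n)"
    and \<pi>: "\<pi> permutes {..<n\<^sup>2}" and l: "l \<in> carrier_vec (n * s_num n)" and v: "v < n\<^sup>2"
    and f: "\<And>i. i < n * s_num n \<Longrightarrow> f (fst (p i)) (snd (p i)) = l $ i"
    and anti: "\<And>a b. f b a = - f a b"
  shows "((A_perm n \<pi>)\<^sup>T *\<^sub>v l) $ \<pi> v = (\<Sum>w\<in>{w. w < n\<^sup>2 \<and> w div n = v div n} - {v}. f v w)"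
proof -
  have v': "\<pi> v < n\<^sup>2"
    using v permutes_in_image[OF \<pi>] by auto
  have p: "bij_betw p {..<n * s_num n} (block_pairs n)"
    using inc A_mat_carrier[OF assms(1)] by (auto simp: oriented_incidence_def)
  have fin: "finite (block_pairs n)"
    using bij_betw_finite[OF p] by simp
  have "((A_perm n \<pi>)\<^sup>T *\<^sub>v l) $ \<pi> v = (\<Sum>i<n * s_num n. A_mat n $$ (i, v) * l $ i)"
    using l v' by (simp add: A_perm_def scalar_prod_def atLeast0LessThan permutes_inverses[OF \<pi>])
  also have "\<dots> = (\<Sum>i<n * s_num n. (\<lambda>(a, b). (of_bool (v = a) - of_bool (v = b)) * f a b) (p i))"
    using inc v A_mat_carrier[OF assms(1)]
    by (intro sum.cong) (auto simp: oriented_incidence_def split_beta f)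
  also have "\<dots> = (\<Sum>(a, b)\<in>block_pairs n. (of_bool (v = a) - of_bool (v = b)) * f a b)"
    by (rule sum.reindex_bij_betw[OF p])
  also have "\<dots> = (\<Sum>(a, b)\<in>{(a, b) \<in> block_pairs n. v = a \<or> v = b}.
      (of_bool (v = a) - of_bool (v = b)) * f a b)"
    using fin by (intro sum.mono_neutral_right) auto
  \<comment> \<open>Edges at \<open>v\<close> correspond to the other vertices \<open>w\<close> of
    its block; sorting \<open>v\<close> and \<open>w\<close> recovers the edge.\<close>
  also have "\<dots> = (\<Sum>w\<in>{w. w < n\<^sup>2 \<and> w div n = v div n} - {v}. f v w)"
    using v by (intro sum.reindex_bij_witness
        [where i = "\<lambda>w. (min v w, max v w)" and j = "\<lambda>(a, b). if v = a then b else a"])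
      (auto simp: block_pairs_def min_def max_def simp flip: anti)
  finally show ?thesis .
qed

section \<open>Block sizes and sums of signs\<close>

lemma block_eq:
  fixes n v :: nat
  assumes "v < n\<^sup>2"
  shows "{w. w < n\<^sup>2 \<and> w div n = v div n} = {v div n * n..<v div n * n + n}"
proof -
  have n: "n > 0"
    using assms by (cases n) auto
  have "v div n < n"
    using assms n by (simp add: less_mult_imp_div_less power2_eq_square)
  \<comment> \<open>The whole interval fits below \<open>n\<^sup>2\<close>, so no block is
    truncated.\<close>
  then have "v div n * n + n \<le> n\<^sup>2"
    by (metis Suc_leI add.commute mult_Suc mult_le_mono1 power2_eq_square)
  moreover have "w div n = q \<longleftrightarrow> q * n \<le> w \<and> w < q * n + n" for w q
  proof
    assume "w div n = q"
    then show "q * n \<le> w \<and> w < q * n + n"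
      using div_mult_mod_eq[of w n] mod_less_divisor[OF n, of w]
      by (metis le_add1 nat_add_left_cancel_less)
  next
    assume "q * n \<le> w \<and> w < q * n + n"
    then show "w div n = q"
      by (intro div_nat_eqI) (simp_all add: algebra_simps)
  qed
  ultimately show ?thesis
    by auto
qed

lemma card_block:
  fixes n v :: nat
  assumes "v < n\<^sup>2"
  shows "card {w. w < n\<^sup>2 \<and> w div n = v div n} = n"
  unfolding block_eq[OF assms] by simp

text \<open>The witness \<open>c\<close> is the number of terms equal to 1.\<close>

lemma sum_signs:
  fixes f :: "'a \<Rightarrow> int"
  assumes "finite S" "\<And>w. w \<in> S \<Longrightarrow> f w \<in> {-1, 1}"
  shows "\<exists>c\<in>{0..int (card S)}. sum f S = 2 * c - int (card S)"
  using assms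
proof (induction S rule: finite_induct)
  case (insert w S)
  then obtain c where c: "c \<in> {0..int (card S)}" "sum f S = 2 * c - int (card S)"
    by blast
  have "f w = -1 \<or> f w = 1"
    using insert.prems by blast
  then show ?case
  proof
    assume "f w = -1"
    then show ?thesis
      using c insert.hyps by (intro bexI[of _ c]) auto
  next
    assume "f w = 1"
    then show ?thesis
      using c insert.hyps by (intro bexI[of _ "c + 1"]) auto
  qed
qed simp

text \<open>There are u - 1 smaller values and n - u larger ones, and their difference is 2u - (n +
  1). This is the score of the player of rank \<open>u\<close> in a transitive tournament.\<close>

lemma sum_sgn_diff:
  fixes n :: nat and u :: int
  assumes "u \<in> {1..int n}"
  shows "(\<Sum>t\<in>{1..int n}. sgn (u - t)) = 2 * u - (int n + 1)"
proof -
  have "{1..int n} = {1..<u} \<union> insert u {u<..int n}"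
    using assms by auto
  then have "(\<Sum>t\<in>{1..int n}. sgn (u - t)) =
      (\<Sum>t\<in>{1..<u}. sgn (u - t)) + (\<Sum>t\<in>insert u {u<..int n}. sgn (u - t))"
    by (simp only:) (rule sum.union_disjoint; auto)
  also have "(\<Sum>t\<in>insert u {u<..int n}. sgn (u - t)) = (\<Sum>t\<in>{u<..int n}. sgn (u - t))"
    by simp
  also have "\<dots> = (\<Sum>t\<in>{u<..int n}. - 1)"
    by (intro sum.cong) auto
  also have "(\<Sum>t\<in>{1..<u}. sgn (u - t)) = (\<Sum>t\<in>{1..<u}. 1)"
    by (intro sum.cong) auto
  finally show ?thesis
    using assms by simp
qed

section \<open>Primal feasibility of finite vectors\<close>

text \<open>\<open>Fin\<close> respects sums and products, so on finite vectors the extended product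
  is the ordinary one and the missing distributivity does no harm.\<close>

lemma mult_mat_zvec_Fin:
  assumes "z \<in> carrier_vec (dim_col B)"
  shows "mult_mat_zvec B (map_vec Fin z) = map_vec Fin (B *\<^sub>v z)"
proof -
  have Fin_sum: "(\<Sum>j\<in>S. Fin (h j)) = Fin (sum h S)" for h :: "nat \<Rightarrow> int" and S
    by (induction S rule: infinite_finite_induct) (auto simp: zero_zinf_def)
  show ?thesis
    using assms
    by (intro eq_vecI)
      (simp_all add: mult_mat_zvec_def scalar_prod_def atLeast0LessThan Fin_sum)
qed

lemma all_nonzero_map_Fin: "all_nonzero (map_vec Fin z) \<longleftrightarrow> all_nonzero z"
  by (auto simp: all_nonzero_def zero_zinf_def)

lemma A_eq_mult_vec:
  assumes "z \<in> carrier_vec (n\<^sup>2)" "j < k" "idx j < n\<^sup>2"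
  shows "(A_eq n k idx *\<^sub>v z) $ j = z $ idx j"
proof -
  have "(A_eq n k idx *\<^sub>v z) $ j = (\<Sum>i<n\<^sup>2. (if i = idx j then 1 else 0) * z $ i)"
    using assms by (simp add: A_eq_def scalar_prod_def atLeast0LessThan)
  then show ?thesis
    using assms by (simp add: if_distrib[where f = "\<lambda>x. x * _"] cong: if_cong)
qed

lemma F_P_Fin_iff:
  assumes z: "z \<in> carrier_vec (n\<^sup>2)" and idx: "\<And>l. l < k \<Longrightarrow> idx l < n\<^sup>2"
  shows "map_vec Fin z \<in> F_P n \<pi> k idx g \<longleftrightarrow>
    (\<forall>i<n\<^sup>2. z $ i \<in> {1..int n}) \<and> (\<forall>r\<in>{1,2,3}. all_nonzero (A_perm n (\<pi> r) *\<^sub>v z)) \<and>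
    (\<forall>l<k. z $ idx l = g (idx l))"
proof -
  have 1: "mult_mat_zvec (A_perm n (\<pi> r)) (map_vec Fin z) = map_vec Fin (A_perm n (\<pi> r) *\<^sub>v z)" for r
    using z by (intro mult_mat_zvec_Fin) (auto simp: A_perm_def)
  have 2: "mult_mat_zvec (A_eq n k idx) (map_vec Fin z) = map_vec Fin (A_eq n k idx *\<^sub>v z)"
    using z by (intro mult_mat_zvec_Fin) (auto simp: A_eq_def)
  have "map_vec Fin (A_eq n k idx *\<^sub>v z) = map_vec Fin (g_vec k idx g) \<longleftrightarrow>
      (\<forall>l<k. (A_eq n k idx *\<^sub>v z) $ l = g (idx l))"
    by (auto simp: vec_eq_iff g_vec_def A_eq_def)
  also have "\<dots> \<longleftrightarrow> (\<forall>l<k. z $ idx l = g (idx l))"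
    using z idx by (auto simp: A_eq_mult_vec)
  finally have 3: "map_vec Fin (A_eq n k idx *\<^sub>v z) = map_vec Fin (g_vec k idx g) \<longleftrightarrow>
      (\<forall>l<k. z $ idx l = g (idx l))" .
  have "map_vec Fin z \<in> carrier_vec (n\<^sup>2)"
    using z by simp
  then show ?thesis
    unfolding F_P_def mem_Collect_eq 1 2 3 all_nonzero_map_Fin using z by auto
qed

text \<open>The rows of \<open>A\<close> sum to zero, so the shift by \<open>n + 1\<close> has no influence.\<close>

lemma all_nonzero_affine:
  assumes "n \<ge> 1" "\<pi> permutes {..<n\<^sup>2}" and y: "y \<in> carrier_vec (n\<^sup>2)" and z: "z \<in> carrier_vec (n\<^sup>2)"
    and yz: "\<And>i. i < n\<^sup>2 \<Longrightarrow> y $ i = 2 * z $ i - (int n + 1)"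
  shows "all_nonzero (A_perm n \<pi> *\<^sub>v y) \<longleftrightarrow> all_nonzero (A_perm n \<pi> *\<^sub>v z)"
proof -
  obtain p where p: "oriented_incidence (A_mat n) p (block_pairs n)"
    using oriented_incidence_A_mat[OF assms(1)] by blast
  have "(A_perm n \<pi> *\<^sub>v y) $ i = 2 * (A_perm n \<pi> *\<^sub>v z) $ i" if i: "i < n * s_num n" for i
  proof -
    have "p i \<in> block_pairs n"
      using p i A_mat_carrier[OF assms(1)] by (auto simp: oriented_incidence_def dest: bij_betwE)
    then have "fst (p i) < n\<^sup>2" "snd (p i) < n\<^sup>2"
      by (auto simp: block_pairs_def)
    then have "\<pi> (fst (p i)) < n\<^sup>2" "\<pi> (snd (p i)) < n\<^sup>2"
      using permutes_in_image[OF assms(2)] by auto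
    then show ?thesis
      unfolding A_mult_vec[OF assms(1) p assms(2) y i] A_mult_vec[OF assms(1) p assms(2) z i]
      by (simp add: yz)
  qed
  then show ?thesis
    by (auto simp: all_nonzero_def A_perm_def)
qed

section \<open>Passing between sign vectors and values in \<open>{1..int n}\<close>\<close>

text \<open>Every vertex has n - 1 opponents in its block, so its score is 2c - (n - 1) with
  \<open>c\<close> its number of wins; the value sought is c + 1.\<close>

lemma dual_to_primal:
  assumes n: "n \<ge> 1" and \<pi>: "\<pi> permutes {..<n\<^sup>2}"
    and l: "l \<in> carrier_vec (n * s_num n)" "\<And>i. i < n * s_num n \<Longrightarrow> l $ i \<in> {-1, 1}"
  obtains z where "z \<in> carrier_vec (n\<^sup>2)" "\<And>i. i < n\<^sup>2 \<Longrightarrow> z $ i \<in> {1..int n}"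
    "\<And>i. i < n\<^sup>2 \<Longrightarrow> ((A_perm n \<pi>)\<^sup>T *\<^sub>v l) $ i = 2 * z $ i - (int n + 1)"
proof -
  obtain p where p: "oriented_incidence (A_mat n) p (block_pairs n)"
    using oriented_incidence_A_mat[OF n] by blast
  have bij: "bij_betw p {..<n * s_num n} (block_pairs n)"
    using p A_mat_carrier[OF n] by (auto simp: oriented_incidence_def)
  define q where "q = inv_into {..<n * s_num n} p"
  have q: "bij_betw q (block_pairs n) {..<n * s_num n}"
    unfolding q_def by (rule bij_betw_inv_into[OF bij])
  \<comment> \<open>The tournament given by \<open>l\<close>. The default 0 on the diagonal and
    between different blocks keeps \<open>f\<close> antisymmetric everywhere.\<close>
  define f where "f a b = (if (a, b) \<in> block_pairs n then l $ q (a, b)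
      else if (b, a) \<in> block_pairs n then - (l $ q (b, a)) else 0)" for a b
  have anti: "f b a = - f a b" for a b
    by (auto simp: f_def block_pairs_def)
  have fp: "f (fst (p i)) (snd (p i)) = l $ i" if "i < n * s_num n" for i
  proof -
    have "p i \<in> block_pairs n" "q (p i) = i"
      using that bij_betw_apply[OF bij] bij_betw_inv_into_left[OF bij, of i] by (simp_all add: q_def)
    then show ?thesis
      by (simp add: f_def)
  qed
  have "\<exists>t\<in>{1..int n}. ((A_perm n \<pi>)\<^sup>T *\<^sub>v l) $ i = 2 * t - (int n + 1)" if i: "i < n\<^sup>2" for i
  proof -
    define v where "v = inv_into UNIV \<pi> i"
    have v: "v < n\<^sup>2" "\<pi> v = i"
      using i permutes_in_image[OF permutes_inv[OF \<pi>]] permutes_inverses[OF \<pi>]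
      by (auto simp: v_def)
    let ?S = "{w. w < n\<^sup>2 \<and> w div n = v div n} - {v}"
    have "card ?S = n - 1"
      using v(1) by (subst card_Diff_singleton) (simp_all add: card_block)
    then have card: "int (card ?S) = int n - 1"
      using n by simp
    have "f v w \<in> {-1, 1}" if "w \<in> ?S" for w
    proof -
      have "(v, w) \<in> block_pairs n \<or> (w, v) \<in> block_pairs n"
        using that v by (auto simp: block_pairs_def)
      moreover have "l $ q e \<in> {-1, 1}" if "e \<in> block_pairs n" for e
        using l(2) bij_betwE[OF q] that by auto
      ultimately show ?thesis
        unfolding f_def by (smt (verit) insert_iff singletonD)
    qed
    then obtain c where "c \<in> {0..int (card ?S)}" "sum (f v) ?S = 2 * c - int (card ?S)"
      using sum_signs[of ?S "f v"] by auto
    \<comment> \<open>As 2c - (n - 1) = 2(c + 1) - (n + 1), a win count in 0..n-1 becomes a value in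
      1..n.\<close>
    then show ?thesis
      using A_transpose_mult_vec[OF n p \<pi> l(1) v(1) fp anti] unfolding card v(2)
      by (intro bexI[of _ "c + 1"]) auto
  qed
  then obtain h where h: "\<And>i. i < n\<^sup>2 \<Longrightarrow> h i \<in> {1..int n} \<and>
      ((A_perm n \<pi>)\<^sup>T *\<^sub>v l) $ i = 2 * h i - (int n + 1)"
    by metis
  show thesis
    by (rule that[of "vec (n\<^sup>2) h"]) (use h in auto)
qed

text \<open>Let the larger value win. Within a block the \<open>n\<close> values are distinct
  members of \<open>{1..int n}\<close>, hence each occurs once, and \<open>sum_sgn_diff\<close>
  computes the scores.\<close>

lemma primal_to_dual:
  assumes n: "n \<ge> 1" and \<pi>: "\<pi> permutes {..<n\<^sup>2}"
    and z: "z \<in> carrier_vec (n\<^sup>2)" "\<And>i. i < n\<^sup>2 \<Longrightarrow> z $ i \<in> {1..int n}"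
    and nz: "all_nonzero (A_perm n \<pi> *\<^sub>v z)"
  obtains l where "l \<in> carrier_vec (n * s_num n)" "\<And>i. i < n * s_num n \<Longrightarrow> l $ i \<in> {-1, 1}"
    "\<And>i. i < n\<^sup>2 \<Longrightarrow> ((A_perm n \<pi>)\<^sup>T *\<^sub>v l) $ i = 2 * z $ i - (int n + 1)"
proof -
  obtain p where p: "oriented_incidence (A_mat n) p (block_pairs n)"
    using oriented_incidence_A_mat[OF n] by blast
  have bij: "bij_betw p {..<n * s_num n} (block_pairs n)"
    using p A_mat_carrier[OF n] by (auto simp: oriented_incidence_def)
  define f where "f a b = sgn (z $ \<pi> a - z $ \<pi> b)" for a b
  define l where "l = vec (n * s_num n) (\<lambda>i. f (fst (p i)) (snd (p i)))"
  have ne: "z $ \<pi> (fst (p i)) \<noteq> z $ \<pi> (snd (p i))" if "i < n * s_num n" for i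
  proof -
    have "(A_perm n \<pi> *\<^sub>v z) $ i \<noteq> 0"
      using nz that by (simp add: all_nonzero_def A_perm_def)
    then show ?thesis
      unfolding A_mult_vec[OF n p \<pi> z(1) that] by simp
  qed
  \<comment> \<open>Every edge owns a row, so the nonzero rows separate all pairs within a
    block.\<close>
  have ne_pairs: "z $ \<pi> a \<noteq> z $ \<pi> b" if "(a, b) \<in> block_pairs n" for a b
  proof -
    have "(a, b) \<in> p ` {..<n * s_num n}"
      using that by (simp add: bij_betw_imp_surj_on[OF bij])
    then obtain i where "i < n * s_num n" "p i = (a, b)"
      by (metis imageE lessThan_iff)
    then show ?thesis
      using ne[of i] by simp
  qed
  have anti: "f b a = - f a b" for a b
    by (simp add: f_def sgn_if)
  have l: "l \<in> carrier_vec (n * s_num n)"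
    by (simp add: l_def)
  have "((A_perm n \<pi>)\<^sup>T *\<^sub>v l) $ i = 2 * z $ i - (int n + 1)" if i: "i < n\<^sup>2" for i
  proof -
    define v where "v = inv_into UNIV \<pi> i"
    have v: "v < n\<^sup>2" "\<pi> v = i"
      using i permutes_in_image[OF permutes_inv[OF \<pi>]] permutes_inverses[OF \<pi>]
      by (auto simp: v_def)
    let ?S = "{w. w < n\<^sup>2 \<and> w div n = v div n}"
    let ?h = "\<lambda>w. z $ \<pi> w"
    have fin: "finite ?S"
      by simp
    have inj: "inj_on ?h ?S"
    proof (rule inj_onI, rule ccontr)
      fix a b assume "a \<in> ?S" "b \<in> ?S" "?h a = ?h b" "a \<noteq> b"
      moreover from this have "(a, b) \<in> block_pairs n \<or> (b, a) \<in> block_pairs n"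
        by (auto simp: block_pairs_def)
      ultimately show False
        using ne_pairs by metis
    qed
    have "?h ` ?S \<subseteq> {1..int n}"
    proof (rule image_subsetI)
      fix w assume "w \<in> ?S"
      then have "\<pi> w < n\<^sup>2"
        using permutes_in_image[OF \<pi>, of w] by simp
      then show "?h w \<in> {1..int n}"
        by (rule z(2))
    qed
    \<comment> \<open>An injection of an \<open>n\<close>-element block into
      \<open>{1..int n}\<close> is onto by counting.\<close>
    moreover have "card (?h ` ?S) = card {1..int n}"
      using card_image[OF inj] v(1) by (simp add: card_block)
    ultimately have img: "?h ` ?S = {1..int n}"
      by (intro card_subset_eq) auto
    have "((A_perm n \<pi>)\<^sup>T *\<^sub>v l) $ \<pi> v = (\<Sum>w\<in>?S - {v}. f v w)"
      by (rule A_transpose_mult_vec[OF n p \<pi> l v(1) _ anti]) (simp add: l_def)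
    \<comment> \<open>The term at \<open>v\<close> itself is \<open>sgn 0 = 0\<close>; including it
      lets the sum run over all of \<open>{1..int n}\<close>.\<close>
    also have "\<dots> = (\<Sum>w\<in>?S. f v w)"
      using fin by (intro sum.mono_neutral_left) (auto simp: f_def)
    also have "\<dots> = (\<Sum>t\<in>?h ` ?S. sgn (z $ i - t))"
      by (subst sum.reindex[OF inj]) (simp add: f_def v)
    also have "\<dots> = 2 * z $ i - (int n + 1)"
      unfolding img using z(2)[OF i] by (rule sum_sgn_diff)
    finally show ?thesis
      using v(2) by simp
  qed
  moreover have "l $ i \<in> {-1, 1}" if "i < n * s_num n" for i
    using ne[OF that] that by (simp add: l_def f_def sgn_if)
  ultimately show thesis
    using l by (intro that)
qed

text \<open>Both directions use the substitution y = 2z - (n + 1), where \<open>y\<close> is the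
  transpose of \<open>A_perm n (\<pi> 1)\<close> applied to \<open>l\<close>. It turns the
  prescribed values g into 2g - (n + 1), and \<open>all_nonzero_affine\<close> carries over the
  inequations for all three permutations.\<close>

lemma finite_primal_iff_dual:
  assumes n: "n \<ge> 1" and \<pi>: "\<And>r. r \<in> {1, 2, 3} \<Longrightarrow> \<pi> r permutes {..<n\<^sup>2}"
    and idx: "\<And>l. l < k \<Longrightarrow> idx l < n\<^sup>2"
  shows "(\<exists>x\<in>F_P n \<pi> k idx g. \<forall>i<n\<^sup>2. x $ i \<noteq> Infty) \<longleftrightarrow>
    (\<exists>l\<in>F_D n \<pi>. \<forall>j<k. (A_eq n k idx *\<^sub>v ((A_perm n (\<pi> 1))\<^sup>T *\<^sub>v l)) $ j
       = 2 * g (idx j) - (int n + 1))"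
    (is "?P \<longleftrightarrow> ?D")
proof
  assume ?P
  then obtain x where x: "x \<in> F_P n \<pi> k idx g" "\<And>i. i < n\<^sup>2 \<Longrightarrow> x $ i \<noteq> Infty"
    by blast
  \<comment> \<open>The value 0 at \<open>Infty\<close> is a dummy: \<open>x\<close> has no infinite
    entry, so \<open>map_vec Fin z\<close> gives back \<open>x\<close>.\<close>
  define z where "z = map_vec (\<lambda>t. case t of Fin u \<Rightarrow> u | Infty \<Rightarrow> 0) x"
  have "x \<in> carrier_vec (n\<^sup>2)"
    using x(1) by (auto simp: F_P_def)
  then have z: "z \<in> carrier_vec (n\<^sup>2)" and "x = map_vec Fin z"
    using x(2) by (auto simp: z_def vec_eq_iff split: zinf.splits)
  then have zF: "\<And>i. i < n\<^sup>2 \<Longrightarrow> z $ i \<in> {1..int n}"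
    "\<And>r. r \<in> {1, 2, 3} \<Longrightarrow> all_nonzero (A_perm n (\<pi> r) *\<^sub>v z)"
    "\<And>l. l < k \<Longrightarrow> z $ idx l = g (idx l)"
    using x(1) F_P_Fin_iff[of z n k idx \<pi> g] idx by blast+
  have \<pi>1: "\<pi> 1 permutes {..<n\<^sup>2}" and nz1: "all_nonzero (A_perm n (\<pi> 1) *\<^sub>v z)"
    using \<pi>[of 1] zF(2)[of 1] by simp_all
  obtain l where l: "l \<in> carrier_vec (n * s_num n)" "\<And>i. i < n * s_num n \<Longrightarrow> l $ i \<in> {-1, 1}"
    and y: "\<And>i. i < n\<^sup>2 \<Longrightarrow> ((A_perm n (\<pi> 1))\<^sup>T *\<^sub>v l) $ i = 2 * z $ i - (int n + 1)"
    by (rule primal_to_dual[OF n \<pi>1 z zF(1) nz1], assumption) (rule that)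
  have yc: "(A_perm n (\<pi> 1))\<^sup>T *\<^sub>v l \<in> carrier_vec (n\<^sup>2)"
    by (intro carrier_vecI) (simp only: A_perm_def dim_mult_mat_vec index_transpose_mat dim_col_mat)
  have "all_nonzero (A_perm n (\<pi> r) *\<^sub>v ((A_perm n (\<pi> 1))\<^sup>T *\<^sub>v l))" if "r \<in> {1, 2, 3}" for r
    using all_nonzero_affine[OF n \<pi>[OF that] yc z y] zF(2)[OF that] by blast
  then have "l \<in> F_D n \<pi>"
    using l by (simp add: F_D_def)
  then show ?D
  proof (intro bexI allI impI)
    fix j assume j: "j < k"
    show "(A_eq n k idx *\<^sub>v ((A_perm n (\<pi> 1))\<^sup>T *\<^sub>v l)) $ j = 2 * g (idx j) - (int n + 1)"
      unfolding A_eq_mult_vec[where idx = idx, OF yc j idx[OF j]] y[OF idx[OF j]] zF(3)[OF j] ..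
  qed
next
  assume ?D
  then obtain l where l: "l \<in> F_D n \<pi>" and
    eq: "\<And>j. j < k \<Longrightarrow> (A_eq n k idx *\<^sub>v ((A_perm n (\<pi> 1))\<^sup>T *\<^sub>v l)) $ j
       = 2 * g (idx j) - (int n + 1)"
    by blast
  have \<pi>1: "\<pi> 1 permutes {..<n\<^sup>2}"
    using \<pi>[of 1] by simp
  have lc: "l \<in> carrier_vec (n * s_num n)" "\<And>i. i < n * s_num n \<Longrightarrow> l $ i \<in> {-1, 1}"
    and lnz: "\<And>r. r \<in> {1, 2, 3} \<Longrightarrow>
      all_nonzero (A_perm n (\<pi> r) *\<^sub>v ((A_perm n (\<pi> 1))\<^sup>T *\<^sub>v l))"
    using l unfolding F_D_def mem_Collect_eq by blast+
  obtain z where z: "z \<in> carrier_vec (n\<^sup>2)" "\<And>i. i < n\<^sup>2 \<Longrightarrow> z $ i \<in> {1..int n}"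
    and y: "\<And>i. i < n\<^sup>2 \<Longrightarrow> ((A_perm n (\<pi> 1))\<^sup>T *\<^sub>v l) $ i = 2 * z $ i - (int n + 1)"
    by (rule dual_to_primal[OF n \<pi>1 lc], assumption) (rule that)
  have yc: "(A_perm n (\<pi> 1))\<^sup>T *\<^sub>v l \<in> carrier_vec (n\<^sup>2)"
    by (intro carrier_vecI) (simp only: A_perm_def dim_mult_mat_vec index_transpose_mat dim_col_mat)
  have "all_nonzero (A_perm n (\<pi> r) *\<^sub>v z)" if "r \<in> {1, 2, 3}" for r
    using all_nonzero_affine[OF n \<pi>[OF that] yc z(1) y] lnz[OF that] by blast
  moreover have "z $ idx j = g (idx j)" if "j < k" for j
    using eq[OF that] A_eq_mult_vec[where idx = idx, OF yc that idx[OF that]] y[OF idx[OF that]] by simp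
  ultimately have "map_vec Fin z \<in> F_P n \<pi> k idx g"
    using F_P_Fin_iff[of z n k idx \<pi> g] z idx by blast
  moreover have "\<forall>i<n\<^sup>2. map_vec Fin z $ i \<noteq> Infty"
    using z(1) by simp
  ultimately show ?P
    by blast
qed

section \<open>Objective bounds and comparison of optimal values\<close>

text \<open>Together with \<open>f_D_bounds\<close>, this makes the sets of objective values finite,
  so that \<open>Min\<close> and \<open>Max\<close> are attained, and puts 0 between the two optimal
  values.\<close>

lemma f_P_bounds: "0 \<le> f_P x" "f_P x \<le> int (dim_vec x)"
proof -
  have "card {i. i < dim_vec x \<and> x $ i = Infty} \<le> card {..<dim_vec x}"
    by (rule card_mono) auto
  then show "f_P x \<le> int (dim_vec x)"
    by (simp add: f_P_def)
qed (simp add: f_P_def)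

lemma f_P_eq_0_iff: "f_P x = 0 \<longleftrightarrow> (\<forall>i<dim_vec x. x $ i \<noteq> Infty)"
  by (auto simp: f_P_def)

lemma f_D_bounds: "- int k \<le> f_D n \<pi> k idx g l" "f_D n \<pi> k idx g l \<le> 0"
proof -
  have "card {j. j < k \<and> (A_eq n k idx *\<^sub>v ((A_perm n (\<pi> 1))\<^sup>T *\<^sub>v l)) $ j
      = 2 * g (idx j) - (int n + 1)} \<le> card {..<k}"
    by (rule card_mono) auto
  then show "f_D n \<pi> k idx g l \<le> 0"
    by (simp add: f_D_def)
qed (simp add: f_D_def)

lemma card_less_filter_eq_iff: "card {j. j < k \<and> Q j} = k \<longleftrightarrow> (\<forall>j<k. Q j)" for k :: nat
proof -
  have "{j. j < k \<and> Q j} \<subseteq> {..<k}"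
    by blast
  from card_subset_eq[OF finite_lessThan this]
  have "card {j. j < k \<and> Q j} = k \<longleftrightarrow> {j. j < k \<and> Q j} = {..<k}"
    by (metis card_lessThan)
  then show ?thesis
    by blast
qed

lemma f_D_eq_0_iff:
  "f_D n \<pi> k idx g l = 0 \<longleftrightarrow> (\<forall>j<k. (A_eq n k idx *\<^sub>v ((A_perm n (\<pi> 1))\<^sup>T *\<^sub>v l)) $ j
     = 2 * g (idx j) - (int n + 1))"
  unfolding f_D_def card_less_filter_eq_iff[symmetric] by linarith

theorem theorem5p3:
  fixes n k :: nat
    and \<pi> :: "nat \<Rightarrow> nat \<Rightarrow> nat"
    and idx :: "nat \<Rightarrow> nat"
    and g :: "nat \<Rightarrow> int"
  assumes "n \<ge> 2"
    and "\<And>r. r \<in> {1, 2, 3} \<Longrightarrow> \<pi> r permutes {..<n\<^sup>2}"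
    and "k \<le> n\<^sup>2"
    and "inj_on idx {..<k}"
    and "\<And>l. l < k \<Longrightarrow> idx l < n\<^sup>2"
    and "\<And>l. l < k \<Longrightarrow> g (idx l) \<in> {1..int n}"
    and "F_P n \<pi> k idx g \<noteq> {}"
    and "F_D n \<pi> \<noteq> {}"
  shows "(v_P n \<pi> k idx g = v_D n \<pi> k idx g
            \<longleftrightarrow> (\<exists>x. solves_P n \<pi> k idx g x \<and> (\<forall>i<n\<^sup>2. x $ i \<noteq> Infty)))
       \<and> ((\<exists>x. solves_P n \<pi> k idx g x \<and> (\<forall>i<n\<^sup>2. x $ i \<noteq> Infty))
            \<longleftrightarrow> (\<exists>l. solves_D n \<pi> k idx g l \<and>
                  A_eq n k idx *\<^sub>v ((A_perm n (\<pi> 1))\<^sup>T *\<^sub>v l)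
                    = 2 \<cdot>\<^sub>v g_vec k idx g - (int n + 1) \<cdot>\<^sub>v vec k (\<lambda>_. 1)))"
proof -
  let ?P = "F_P n \<pi> k idx g" and ?D = "F_D n \<pi>"
  have "f_P ` ?P \<subseteq> {0..int (n\<^sup>2)}"
    using f_P_bounds by (auto simp: F_P_def) (metis carrier_vecD of_nat_power)
  then have finP: "finite (f_P ` ?P)"
    by (rule finite_subset) simp
  have "f_D n \<pi> k idx g ` ?D \<subseteq> {- int k..0}"
    using f_D_bounds by auto
  then have finD: "finite (f_D n \<pi> k idx g ` ?D)"
    by (rule finite_subset) simp
  have vP: "v_P n \<pi> k idx g \<in> f_P ` ?P" "\<And>x. x \<in> ?P \<Longrightarrow> v_P n \<pi> k idx g \<le> f_P x"
    using finP assms(7) by (auto simp: v_P_def intro!: Min_in)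
  have vD: "v_D n \<pi> k idx g \<in> f_D n \<pi> k idx g ` ?D"
    "\<And>l. l \<in> ?D \<Longrightarrow> f_D n \<pi> k idx g l \<le> v_D n \<pi> k idx g"
    using finD assms(8) by (auto simp: v_D_def intro!: Max_in)
  have vP0: "0 \<le> v_P n \<pi> k idx g"
    using vP(1) f_P_bounds by auto
  have vD0: "v_D n \<pi> k idx g \<le> 0"
    using vD(1) f_D_bounds by auto
  have finite_iff: "(\<forall>i<n\<^sup>2. x $ i \<noteq> Infty) \<longleftrightarrow> f_P x = 0" if "x \<in> ?P" for x
    using that f_P_eq_0_iff[of x] by (auto simp: F_P_def)
  have eq_iff: "A_eq n k idx *\<^sub>v ((A_perm n (\<pi> 1))\<^sup>T *\<^sub>v l)
      = 2 \<cdot>\<^sub>v g_vec k idx g - (int n + 1) \<cdot>\<^sub>v vec k (\<lambda>_. 1) \<longleftrightarrow> f_D n \<pi> k idx g l = 0" for l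
    unfolding f_D_eq_0_iff by (auto simp: vec_eq_iff A_eq_def g_vec_def)
  have "n \<ge> 1"
    using assms(1) by simp
  from finite_primal_iff_dual[where \<pi> = \<pi> and k = k and idx = idx and g = g, OF this assms(2,5)]
  have key: "(\<exists>x\<in>?P. f_P x = 0) \<longleftrightarrow> (\<exists>l\<in>?D. f_D n \<pi> k idx g l = 0)"
    using finite_iff by (simp add: f_D_eq_0_iff)
  \<comment> \<open>Zero bounds both objectives, so a feasible point with objective 0 is optimal.
    All four conditions below thus reduce to the vanishing of an optimal value.\<close>
  have "(\<exists>x\<in>?P. f_P x = 0) \<longleftrightarrow> v_P n \<pi> k idx g = 0"
    using vP vP0 by fastforce
  moreover have "(\<exists>l\<in>?D. f_D n \<pi> k idx g l = 0) \<longleftrightarrow> v_D n \<pi> k idx g = 0"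
    using vD vD0 by fastforce
  moreover have "(\<exists>x. solves_P n \<pi> k idx g x \<and> (\<forall>i<n\<^sup>2. x $ i \<noteq> Infty)) \<longleftrightarrow>
      v_P n \<pi> k idx g = 0"
    using vP(1) finite_iff unfolding solves_P_def by (metis imageE)
  moreover have "(\<exists>l. solves_D n \<pi> k idx g l \<and> A_eq n k idx *\<^sub>v ((A_perm n (\<pi> 1))\<^sup>T *\<^sub>v l)
      = 2 \<cdot>\<^sub>v g_vec k idx g - (int n + 1) \<cdot>\<^sub>v vec k (\<lambda>_. 1)) \<longleftrightarrow> v_D n \<pi> k idx g = 0"
    unfolding eq_iff using vD(1) by (auto simp: solves_D_def image_iff)
  \<comment> \<open>By \<open>key\<close> the two optimal values vanish together, and since 0
    separates them, they are equal only if both vanish.\<close>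
  ultimately show ?thesis
    using key vP0 vD0 by auto
qed

end
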